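(* Let $0\le k<n$ and let $\begin{bmatrix}T(0)\\ P(0)\end{bmatrix}\in X_{n,k}$ be written as $$P(0)=a\begin{bmatrix}I_{p\times p}&0&0\\ 0&\mathrm{diag}[c_i]_{q\times q}&0\\ 0&0&0_{r\times r}\end{bmatrix}b^*,\qquad T(0)=m\begin{bmatrix}0_{p'\times p}&0&0\\ 0&\mathrm{diag}[-s_i]_{q\times q}&0\\ 0&0&-I_{r\times r}\end{bmatrix}b^*,$$ with $a,b\in\mathrm{Sp}(k)$, $m\in\mathrm{Sp}(n-k)$, $p,p',q,r\ge 0$, $p+q+r=k$, $p'+q+r=n-k$, $0<c_i<1$ and $s_i=\sqrt{1-c_i^2}$ for $i=1,\dots,q$. For each $i$ let $C_i>0$ be such that $c_i^2=\frac{C_i}{1+C_i}$, and let $$P(t)=a\begin{bmatrix}I_{p\times p}&0&0\\ 0&\mathrm{diag}[c_i(t)]_{q\times q}&0\\ 0&0&0_{r\times r}\end{bmatrix}b^*,\qquad c_i(t)>0,\quad c_i(t)^2=\frac{C_ie^{4t}}{1+C_ie^{4t}}.$$ Then the solution of the equation $T'=-2TP^*P$ (with this $P=P(t)$ and with initial condition $T(0)$) is $$T(t)=m\begin{bmatrix}0_{p'\times p}&0&0\\ 0&\mathrm{diag}[-s_i(t)]_{q\times q}&0\\ 0&0&-I_{r\times r}\end{bmatrix}b^*,$$ where $s_i(t)>0$ is given by $$s_i(t)^2=1-c_i(t)^2=\frac{1}{1+C_ie^{4t}}.$$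
   Context: $\mathrm{Sp}(k)$ is the group of $k\times k$ quaternionic matrices $A$ with $A^*A=I_k$. $X_{n,k}$ is the quaternionic Stiefel manifold of matrices $x\in\mathbb{H}^{n\times k}$ with $x^*x=I_k$, written in blocks $x=\begin{bmatrix}T\\ P\end{bmatrix}$ with $T\in\mathbb{H}^{(n-k)\times k}$, $P\in\mathbb{H}^{k\times k}$. The prime denotes the derivative with respect to the real variable $t$. The equation is the $T$-component of the gradient flow equation $\alpha'(t)=\mathrm{grad}\, h_{\alpha(t)}$, $\alpha=\begin{bmatrix}T\\ P\end{bmatrix}$, of the function $h(x)=\mathrm{Tr}(P^*P)$ on $X_{n,k}$, which reads $T'=-2TP^*P$, $P'=-2(PP^*-I_k)P$; the given $P(t)$ is the solution of the second equation with initial value $P(0)$. *)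

theory Defs
  imports Complex_Main "Jordan_Normal_Form.Matrix"
begin

section \<open>Quaternions\<close>

codatatype quat = Quat (qRe: real) (qI: real) (qJ: real) (qK: real)

lemma quat_eq_iff: "x = y \<longleftrightarrow> qRe x = qRe y \<and> qI x = qI y \<and> qJ x = qJ y \<and> qK x = qK y"
  by (auto intro: quat.expand)

instantiation quat :: ab_group_add
begin

primcorec zero_quat where
  "qRe 0 = 0" | "qI 0 = 0" | "qJ 0 = 0" | "qK 0 = 0"

primcorec plus_quat where
  "qRe (x + y) = qRe x + qRe y"
| "qI (x + y) = qI x + qI y"
| "qJ (x + y) = qJ x + qJ y"
| "qK (x + y) = qK x + qK y"

primcorec uminus_quat where
  "qRe (- x) = - qRe x"
| "qI (- x) = - qI x"
| "qJ (- x) = - qJ x"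
| "qK (- x) = - qK x"

primcorec minus_quat where
  "qRe (x - y) = qRe x - qRe y"
| "qI (x - y) = qI x - qI y"
| "qJ (x - y) = qJ x - qJ y"
| "qK (x - y) = qK x - qK y"

instance
  by standard (simp_all add: quat_eq_iff)

end

instantiation quat :: ring_1
begin

primcorec one_quat where
  "qRe 1 = 1" | "qI 1 = 0" | "qJ 1 = 0" | "qK 1 = 0"

primcorec times_quat where
  "qRe (x * y) = qRe x * qRe y - qI x * qI y - qJ x * qJ y - qK x * qK y"
| "qI (x * y) = qRe x * qI y + qI x * qRe y + qJ x * qK y - qK x * qJ y"
| "qJ (x * y) = qRe x * qJ y - qI x * qK y + qJ x * qRe y + qK x * qI y"
| "qK (x * y) = qRe x * qK y + qI x * qJ y - qJ x * qI y + qK x * qRe y"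

instance
proof
  show "(0 :: quat) \<noteq> 1"
    by (simp add: quat_eq_iff)
qed (simp_all add: quat_eq_iff algebra_simps)

end

instantiation quat :: real_algebra_1
begin

primcorec scaleR_quat where
  "qRe (scaleR r x) = r * qRe x"
| "qI (scaleR r x) = r * qI x"
| "qJ (scaleR r x) = r * qJ x"
| "qK (scaleR r x) = r * qK x"

instance
  by standard (simp_all add: quat_eq_iff algebra_simps)

end

primcorec qcnj :: "quat \<Rightarrow> quat" where
  "qRe (qcnj x) = qRe x"
| "qI (qcnj x) = - qI x"
| "qJ (qcnj x) = - qJ x"
| "qK (qcnj x) = - qK x"

instantiation quat :: real_div_algebra
begin

definition inverse_quat :: "quat \<Rightarrow> quat" where
  "inverse x = qcnj x /\<^sub>R ((qRe x)\<^sup>2 + (qI x)\<^sup>2 + (qJ x)\<^sup>2 + (qK x)\<^sup>2)"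

definition divide_quat :: "quat \<Rightarrow> quat \<Rightarrow> quat" where
  "x div y = x * inverse y" for x y :: quat

instance
proof
  fix x y :: quat
  assume "x \<noteq> 0"
  then have "(qRe x)\<^sup>2 + (qI x)\<^sup>2 + (qJ x)\<^sup>2 + (qK x)\<^sup>2 \<noteq> 0"
    by (auto simp: quat_eq_iff add_nonneg_eq_0_iff)
  then show "inverse x * x = 1" "x * inverse x = 1"
    by (simp_all add: quat_eq_iff inverse_quat_def field_simps power2_eq_square)
next
  show "x div y = x * inverse y" for x y :: quat
    by (simp add: divide_quat_def)
  show "inverse (0 :: quat) = 0"
    by (simp add: inverse_quat_def quat_eq_iff)
qed

end

instantiation quat :: real_normed_div_algebra
begin

definition norm_quat :: "quat \<Rightarrow> real" where
  "norm x = sqrt ((qRe x)\<^sup>2 + (qI x)\<^sup>2 + (qJ x)\<^sup>2 + (qK x)\<^sup>2)"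

definition sgn_quat :: "quat \<Rightarrow> quat" where
  "sgn x = inverse (norm x) *\<^sub>R x" for x :: quat

definition dist_quat :: "quat \<Rightarrow> quat \<Rightarrow> real" where
  "dist x y = norm (x - y)" for x y :: quat

definition uniformity_quat :: "(quat \<times> quat) filter" where
  "uniformity_quat = (INF e\<in>{0 <..}. principal {(x, y). dist x y < e})"

definition open_quat :: "quat set \<Rightarrow> bool" where
  "open_quat U \<longleftrightarrow> (\<forall>x\<in>U. eventually (\<lambda>(x', y). x' = x \<longrightarrow> y \<in> U) uniformity)"

instance
proof
  fix r :: real and x y :: quat and S :: "quat set"
  show "norm x = 0 \<longleftrightarrow> x = 0"
    by (auto simp: norm_quat_def quat_eq_iff add_nonneg_eq_0_iff)
  show "norm (x + y) \<le> norm x + norm y"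
  proof -
    define u v where "u = Complex (qRe x) (qI x)" and "v = Complex (qJ x) (qK x)"
    define u' v' where "u' = Complex (qRe y) (qI y)" and "v' = Complex (qJ y) (qK y)"
    have nx: "norm x = sqrt ((cmod u)\<^sup>2 + (cmod v)\<^sup>2)"
      by (simp add: norm_quat_def u_def v_def cmod_power2)
    have ny: "norm y = sqrt ((cmod u')\<^sup>2 + (cmod v')\<^sup>2)"
      by (simp add: norm_quat_def u'_def v'_def cmod_power2)
    have "norm (x + y) = sqrt ((cmod (u + u'))\<^sup>2 + (cmod (v + v'))\<^sup>2)"
      by (simp add: norm_quat_def u_def v_def u'_def v'_def cmod_power2)
    also have "\<dots> \<le> sqrt ((cmod u + cmod u')\<^sup>2 + (cmod v + cmod v')\<^sup>2)"
      by (intro real_sqrt_le_mono add_mono power_mono norm_triangle_ineq norm_ge_zero)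
    also have "\<dots> \<le> norm x + norm y"
      unfolding nx ny by (rule real_sqrt_sum_squares_triangle_ineq)
    finally show ?thesis .
  qed
  show "norm (scaleR r x) = \<bar>r\<bar> * norm x"
    by (simp add: norm_quat_def power_mult_distrib real_sqrt_mult flip: distrib_left)
  show "norm (x * y) = norm x * norm y"
    unfolding norm_quat_def real_sqrt_mult[symmetric]
    by (rule arg_cong[where f = sqrt]) (simp add: power2_eq_square algebra_simps)
qed (rule sgn_quat_def dist_quat_def open_quat_def uniformity_quat_def)+

end


section \<open>Quaternionic matrices\<close>

definition qadjoint :: "quat mat \<Rightarrow> quat mat" where
  "qadjoint A = map_mat qcnj (transpose_mat A)"

definition Sp :: "nat \<Rightarrow> quat mat set" where
  "Sp k = {A \<in> carrier_mat k k. qadjoint A * A = 1\<^sub>m k}"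

definition stiefel :: "nat \<Rightarrow> nat \<Rightarrow> quat mat set" where
  "stiefel n k = {x \<in> carrier_mat n k. qadjoint x * x = 1\<^sub>m k}"

definition real_diag :: "nat \<Rightarrow> (nat \<Rightarrow> real) \<Rightarrow> quat mat" where
  "real_diag q d = mat_diag q (\<lambda>i. of_real (d i))"

definition has_mat_derivative ::
    "(real \<Rightarrow> quat mat) \<Rightarrow> quat mat \<Rightarrow> real filter \<Rightarrow> bool" where
  "has_mat_derivative F D L \<longleftrightarrow>
     (\<forall>i < dim_row D. \<forall>j < dim_col D.
        ((\<lambda>t. F t $$ (i, j)) has_vector_derivative D $$ (i, j)) L)"

text \<open>
  \<open>T_solution l k P T0 J T\<close>: on the interval \<open>J\<close>, \<open>T\<close> is an \<open>l \<times> k\<close> matrix solution of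
  \<open>T' = -2 T P\<^sup>* P\<close> with initial value \<open>T0\<close>.  At an endpoint of \<open>J\<close> that belongs to \<open>J\<close> the derivative is one-sided; on
  \<open>J = UNIV\<close> it is the ordinary derivative.
\<close>

definition T_solution ::
    "nat \<Rightarrow> nat \<Rightarrow> (real \<Rightarrow> quat mat) \<Rightarrow> quat mat \<Rightarrow> real set \<Rightarrow> (real \<Rightarrow> quat mat) \<Rightarrow> bool" where
  "T_solution l k P T0 J T \<longleftrightarrow>
     T 0 = T0 \<and>
     (\<forall>t\<in>J. T t \<in> carrier_mat l k \<and>
        has_mat_derivative T ((-2) \<cdot>\<^sub>m (T t * qadjoint (P t) * P t)) (at t within J))"

end

theory Submission
  imports Defs "HOL-Analysis.Derivative"
begin

text \<open>
  Because \<open>a\<^sup>* a = b\<^sup>* b = 1\<close>, the coefficient of the equation is \<open>P\<^sup>* P = b G b\<^sup>*\<close> with \<open>G\<close> real and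
  diagonal: its entries are \<open>1\<close> in the first block, \<open>c\<^sub>i(t)\<^sup>2\<close> in the second and \<open>0\<close> in the third.
  Real numbers are central in the quaternions, so multiplication by \<open>G\<close> on the right only rescales
  columns, and in the right frame the equation \<open>T' = -2 T P\<^sup>* P\<close> decouples into the scalar
  equations \<open>w' = -2 g w\<close>.

  For existence, substitute \<open>T = m B b\<^sup>*\<close>. The equation then says that each entry of \<open>B\<close> in column \<open>j\<close>
  solves \<open>w' = -2 g\<^sub>j w\<close> (\<open>T_solution_of_columnwise_decay\<close>). The entries of the block matrix \<open>B\<close> are
  \<open>0\<close>, which solves it for every \<open>g\<^sub>j\<close>; \<open>-1\<close>, which occurs only in columns with \<open>g\<^sub>j = 0\<close>; and
  \<open>-s\<^sub>i\<close>, for which the equation is \<open>s\<^sub>i' = -2 c\<^sub>i\<^sup>2 s\<^sub>i\<close> (\<open>logistic_sine_derivative\<close>).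

  For uniqueness (\<open>T_solution_unique\<close>), the entries of \<open>S b\<close> solve the same scalar equations for any
  solution \<open>S\<close>, and an integrating factor determines them from the initial value. The derivative
  of \<open>S\<close> depends on \<open>S\<close> only through \<open>S b\<close>, so two solutions with the same initial value have the same
  derivative, and hence agree.
\<close>

section \<open>Quaternionic matrices and their adjoints\<close>

lemma qcnj_0 [simp]: "qcnj 0 = 0"
  and qcnj_qcnj [simp]: "qcnj (qcnj x) = x"
  and qcnj_add: "qcnj (x + y) = qcnj x + qcnj y"
  and qcnj_mult: "qcnj (x * y) = qcnj y * qcnj x"
  and qcnj_of_real [simp]: "qcnj (of_real r) = of_real r"
  by (simp_all add: quat_eq_iff of_real_def algebra_simps)

lemma qcnj_sum: "qcnj (sum f A) = (\<Sum>x\<in>A. qcnj (f x))"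
  by (induction A rule: infinite_finite_induct) (simp_all add: qcnj_add)

lemma mat_mult_entry:
  assumes "A \<in> carrier_mat l n" "B \<in> carrier_mat n m" "i < l" "j < m"
  shows "(A * B) $$ (i, j) = (\<Sum>x<n. A $$ (i, x) * B $$ (x, j))"
  using assms by (simp add: scalar_prod_def atLeast0LessThan)

lemma smult_mat_mult:
  fixes A B :: "quat mat"
  assumes A: "A \<in> carrier_mat l n" and B: "B \<in> carrier_mat n m"
  shows "(x \<cdot>\<^sub>m A) * B = x \<cdot>\<^sub>m (A * B)"
proof (rule eq_matI)
  fix i j assume "i < dim_row (x \<cdot>\<^sub>m (A * B))" "j < dim_col (x \<cdot>\<^sub>m (A * B))"
  hence i: "i < l" and j: "j < m" using A B by simp_all
  show "((x \<cdot>\<^sub>m A) * B) $$ (i, j) = (x \<cdot>\<^sub>m (A * B)) $$ (i, j)"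
    using A B i j mat_mult_entry[OF smult_carrier_mat[OF A] B i j] mat_mult_entry[OF A B i j]
    by (simp add: sum_distrib_left mult.assoc del: index_mult_mat(1))
qed (use A B in simp_all)

text \<open>
  Pulling a scalar out of the right factor moves it past the entries of \<open>A\<close>, so it has to be
  central. The central quaternions are the reals; the differential equation contains the scalar \<open>-2\<close>.
\<close>

lemma mat_mult_smult_of_real:
  fixes A B :: "quat mat"
  assumes A: "A \<in> carrier_mat l n" and B: "B \<in> carrier_mat n m"
  shows "A * (of_real x \<cdot>\<^sub>m B) = of_real x \<cdot>\<^sub>m (A * B)"
proof (rule eq_matI)
  fix i j assume "i < dim_row (of_real x \<cdot>\<^sub>m (A * B))" "j < dim_col (of_real x \<cdot>\<^sub>m (A * B))"
  hence i: "i < l" and j: "j < m" using A B by simp_all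
  show "(A * (of_real x \<cdot>\<^sub>m B)) $$ (i, j) = (of_real x \<cdot>\<^sub>m (A * B)) $$ (i, j)"
    using A B i j mat_mult_entry[OF A smult_carrier_mat[OF B] i j] mat_mult_entry[OF A B i j]
    by (simp add: sum_distrib_left of_real_def scaleR_sum_right del: index_mult_mat(1))
qed (use A B in simp_all)

lemma qadjoint_carrier [simp]: "A \<in> carrier_mat l m \<Longrightarrow> qadjoint A \<in> carrier_mat m l"
  by (simp add: qadjoint_def)

lemma qadjoint_entry:
  "A \<in> carrier_mat l m \<Longrightarrow> i < m \<Longrightarrow> j < l \<Longrightarrow> qadjoint A $$ (i, j) = qcnj (A $$ (j, i))"
  by (simp add: qadjoint_def)

lemma qadjoint_mult:
  assumes A: "A \<in> carrier_mat l n" and B: "B \<in> carrier_mat n m"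
  shows "qadjoint (A * B) = qadjoint B * qadjoint A"
proof (rule eq_matI)
  fix i j assume "i < dim_row (qadjoint B * qadjoint A)" "j < dim_col (qadjoint B * qadjoint A)"
  hence i: "i < m" and j: "j < l" using A B by (simp_all add: qadjoint_def)
  have "qadjoint (A * B) $$ (i, j) = qcnj ((A * B) $$ (j, i))"
    by (rule qadjoint_entry[OF mult_carrier_mat[OF A B] i j])
  also have "\<dots> = (\<Sum>x<n. qcnj (B $$ (x, i)) * qcnj (A $$ (j, x)))"
    by (simp add: mat_mult_entry[OF A B j i] qcnj_sum qcnj_mult)
  also have "\<dots> = (\<Sum>x<n. qadjoint B $$ (i, x) * qadjoint A $$ (x, j))"
    by (intro sum.cong refl) (simp add: qadjoint_entry[OF A _ j] qadjoint_entry[OF B i])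
  also have "\<dots> = (qadjoint B * qadjoint A) $$ (i, j)"
    by (rule mat_mult_entry[symmetric, OF qadjoint_carrier[OF B] qadjoint_carrier[OF A] i j])
  finally show "qadjoint (A * B) $$ (i, j) = (qadjoint B * qadjoint A) $$ (i, j)" .
qed (use A B in \<open>simp_all add: qadjoint_def\<close>)

lemma qadjoint_qadjoint [simp]: "qadjoint (qadjoint A) = A"
  by (rule eq_matI) (simp_all add: qadjoint_def)

lemma real_diag_carrier [simp]: "real_diag k d \<in> carrier_mat k k"
  by (simp add: real_diag_def)

lemma qadjoint_real_diag [simp]: "qadjoint (real_diag k d) = real_diag k d"
  by (rule eq_matI) (auto simp: qadjoint_def real_diag_def mat_diag_def)

lemma real_diag_mult: "real_diag k d * real_diag k e = real_diag k (\<lambda>i. d i * e i)"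
  by (simp add: real_diag_def)

lemma mult_real_diag_entry:
  assumes "A \<in> carrier_mat l k" "i < l" "j < k"
  shows "(A * real_diag k d) $$ (i, j) = d j *\<^sub>R A $$ (i, j)"
  unfolding real_diag_def
  by (subst mat_diag_mult_right[OF assms(1)]) (use assms in \<open>simp add: of_real_def\<close>)

lemma SpD:
  assumes "A \<in> Sp k"
  shows "A \<in> carrier_mat k k" and "qadjoint A \<in> carrier_mat k k" and "qadjoint A * A = 1\<^sub>m k"
  using assms by (simp_all add: Sp_def)

text \<open>
  The relation \<open>b\<^sup>* b = 1\<close> is used in this form: inside a longer product, a frame \<open>b\<^sup>*\<close> followed by \<open>b\<close>
  cancels.
\<close>

lemma mult_qadjoint_mult_Sp:
  assumes X: "X \<in> carrier_mat l k" and b: "b \<in> Sp k"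
  shows "X * qadjoint b * b = X"
  using assoc_mult_mat[OF X SpD(2)[OF b] SpD(1)[OF b]] SpD(3)[OF b] X by simp

text \<open>
  In \<open>P\<^sup>* P\<close> the two copies of the left frame meet as \<open>a\<^sup>* a = 1\<close>, so only \<open>b\<close> survives.
\<close>

lemma gram_singular_value_form:
  assumes a: "a \<in> Sp k" and b: "b \<in> Sp k"
    and P: "P = a * real_diag k d * qadjoint b"
  shows "P \<in> carrier_mat k k"
    and "qadjoint P * P = b * real_diag k (\<lambda>j. (d j)\<^sup>2) * qadjoint b"
proof -
  let ?D = "real_diag k d"
  note a' = SpD[OF a] and b' = SpD[OF b]
  have D: "?D \<in> carrier_mat k k" by simp
  have aD: "a * ?D \<in> carrier_mat k k" using a' by simp
  have bD: "b * ?D \<in> carrier_mat k k" using b' by simp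
  show carr: "P \<in> carrier_mat k k" unfolding P using aD b' by simp
  have "qadjoint P = b * (?D * qadjoint a)"
    by (simp add: P qadjoint_mult[OF aD b'(2)] qadjoint_mult[OF a'(1) D])
  also have "\<dots> = b * ?D * qadjoint a"
    by (rule assoc_mult_mat[symmetric, OF b'(1) D a'(2)])
  finally have adj: "qadjoint P = b * ?D * qadjoint a" .
  have "qadjoint P * P = qadjoint P * (a * ?D) * qadjoint b"
    by (subst (2) P) (rule assoc_mult_mat[symmetric, OF qadjoint_carrier[OF carr] aD b'(2)])
  also have "qadjoint P * (a * ?D) = qadjoint P * a * ?D"
    by (rule assoc_mult_mat[symmetric, OF qadjoint_carrier[OF carr] a'(1) D])
  also have "qadjoint P * a = b * ?D"
    unfolding adj by (rule mult_qadjoint_mult_Sp[OF bD a])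
  also have "b * ?D * ?D = b * (?D * ?D)"
    by (rule assoc_mult_mat[OF b'(1) D D])
  also have "?D * ?D = real_diag k (\<lambda>j. (d j)\<^sup>2)"
    by (simp add: real_diag_mult power2_eq_square)
  finally show "qadjoint P * P = b * real_diag k (\<lambda>j. (d j)\<^sup>2) * qadjoint b" .
qed

text \<open>
  With the brackets moved to the left, the right-hand side of the differential equation is seen to
  depend on \<open>X\<close> only through \<open>X b\<close>.
\<close>

lemma mult_gram_singular_value_form:
  assumes X: "X \<in> carrier_mat l k" and P: "P \<in> carrier_mat k k" and b: "b \<in> Sp k"
    and gram: "qadjoint P * P = b * real_diag k g * qadjoint b"
  shows "X * qadjoint P * P = X * b * real_diag k g * qadjoint b"
proof -
  note b' = SpD[OF b]
  have D: "real_diag k g \<in> carrier_mat k k" by simp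
  have "X * qadjoint P * P = X * (b * real_diag k g * qadjoint b)"
    unfolding gram[symmetric] by (rule assoc_mult_mat[OF X qadjoint_carrier[OF P] P])
  also have "\<dots> = X * (b * real_diag k g) * qadjoint b"
    by (rule assoc_mult_mat[symmetric, OF X mult_carrier_mat[OF b'(1) D] b'(2)])
  also have "X * (b * real_diag k g) = X * b * real_diag k g"
    by (rule assoc_mult_mat[symmetric, OF X b'(1) D])
  finally show ?thesis .
qed

section \<open>Differentiating matrix products\<close>

lemma has_mat_derivative_mult_left:
  assumes A: "A \<in> carrier_mat l n" and D: "D \<in> carrier_mat n m"
    and t: "t \<in> J" and F: "\<And>u. u \<in> J \<Longrightarrow> F u \<in> carrier_mat n m"
    and deriv: "has_mat_derivative F D (at t within J)"
  shows "has_mat_derivative (\<lambda>u. A * F u) (A * D) (at t within J)"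
  unfolding has_mat_derivative_def
proof (intro allI impI)
  fix i j assume "i < dim_row (A * D)" "j < dim_col (A * D)"
  hence i: "i < l" and j: "j < m" using A D by simp_all
  have "((\<lambda>u. \<Sum>x<n. A $$ (i, x) * F u $$ (x, j)) has_vector_derivative
      (\<Sum>x<n. A $$ (i, x) * D $$ (x, j))) (at t within J)"
    by (intro has_vector_derivative_sum has_vector_derivative_mult_right)
      (use deriv D j in \<open>simp add: has_mat_derivative_def\<close>)
  then show "((\<lambda>u. (A * F u) $$ (i, j)) has_vector_derivative (A * D) $$ (i, j)) (at t within J)"
    unfolding mat_mult_entry[OF A D i j]
    by (rule has_vector_derivative_transform[OF t, rotated]) (rule mat_mult_entry[OF A F i j])
qed

lemma has_mat_derivative_mult_right:
  assumes B: "B \<in> carrier_mat n m" and D: "D \<in> carrier_mat l n"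
    and t: "t \<in> J" and F: "\<And>u. u \<in> J \<Longrightarrow> F u \<in> carrier_mat l n"
    and deriv: "has_mat_derivative F D (at t within J)"
  shows "has_mat_derivative (\<lambda>u. F u * B) (D * B) (at t within J)"
  unfolding has_mat_derivative_def
proof (intro allI impI)
  fix i j assume "i < dim_row (D * B)" "j < dim_col (D * B)"
  hence i: "i < l" and j: "j < m" using B D by simp_all
  have "((\<lambda>u. \<Sum>x<n. F u $$ (i, x) * B $$ (x, j)) has_vector_derivative
      (\<Sum>x<n. D $$ (i, x) * B $$ (x, j))) (at t within J)"
    by (intro has_vector_derivative_sum has_vector_derivative_mult_left)
      (use deriv D i in \<open>simp add: has_mat_derivative_def\<close>)
  then show "((\<lambda>u. (F u * B) $$ (i, j)) has_vector_derivative (D * B) $$ (i, j)) (at t within J)"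
    unfolding mat_mult_entry[OF D B i j]
    by (rule has_vector_derivative_transform[OF t, rotated]) (rule mat_mult_entry[OF F B i j])
qed

section \<open>Existence\<close>

text \<open>
  Both sides of the equation for \<open>m B b\<^sup>*\<close> have the form \<open>m \<dots> b\<^sup>*\<close>: the left side because the frames are
  constant, the right side because \<open>b\<^sup>* b\<close> cancels, leaving \<open>-2 m (B G) b\<^sup>*\<close>. So it suffices that
  \<open>B' = -2 B G\<close>, which is a condition on the single entries.
\<close>

lemma T_solution_of_columnwise_decay:
  assumes m: "m \<in> carrier_mat l l" and b: "b \<in> Sp k"
    and P: "\<And>t. P t \<in> carrier_mat k k"
    and gram: "\<And>t. qadjoint (P t) * P t = b * real_diag k (g t) * qadjoint b"
    and B: "\<And>t. B t \<in> carrier_mat l k"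
    and deriv: "\<And>i j t. i < l \<Longrightarrow> j < k \<Longrightarrow>
      ((\<lambda>t. B t $$ (i, j)) has_vector_derivative (- (2 * g t j)) *\<^sub>R B t $$ (i, j)) (at t)"
  shows "T_solution l k P (m * B 0 * qadjoint b) UNIV (\<lambda>t. m * B t * qadjoint b)"
  unfolding T_solution_def
proof (intro conjI ballI refl)
  fix t :: real
  note b' = SpD[OF b]
  let ?G = "real_diag k (g t)" and ?X = "m * B t * qadjoint b"
  have G: "?G \<in> carrier_mat k k" by simp
  have mB: "m * B u \<in> carrier_mat l k" for u by (rule mult_carrier_mat[OF m B])
  have BG: "B t * ?G \<in> carrier_mat l k" by (rule mult_carrier_mat[OF B G])
  show X: "?X \<in> carrier_mat l k" by (rule mult_carrier_mat[OF mB b'(2)])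
  have "has_mat_derivative B ((-2) \<cdot>\<^sub>m (B t * ?G)) (at t within UNIV)"
    unfolding has_mat_derivative_def
  proof (intro allI impI)
    fix i j assume "i < dim_row ((-2) \<cdot>\<^sub>m (B t * ?G))" "j < dim_col ((-2) \<cdot>\<^sub>m (B t * ?G))"
    hence i: "i < l" and j: "j < k" using carrier_matD[OF smult_carrier_mat[OF BG]] by simp_all
    have "((-2) \<cdot>\<^sub>m (B t * ?G)) $$ (i, j) = (-2) * (g t j *\<^sub>R B t $$ (i, j))"
      using mult_real_diag_entry[OF B i j] carrier_matD[OF BG] i j by (simp del: index_mult_mat)
    also have "\<dots> = (- (2 * g t j)) *\<^sub>R B t $$ (i, j)"
      by (simp add: scaleR_conv_of_real mult.assoc del: index_mult_mat)
    finally show "((\<lambda>t. B t $$ (i, j)) has_vector_derivative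
        ((-2) \<cdot>\<^sub>m (B t * ?G)) $$ (i, j)) (at t within UNIV)"
      using deriv[OF i j] by simp
  qed
  from has_mat_derivative_mult_left[OF m smult_carrier_mat[OF BG] UNIV_I B this]
  have "has_mat_derivative (\<lambda>u. m * B u) (m * ((-2) \<cdot>\<^sub>m (B t * ?G))) (at t within UNIV)" .
  from has_mat_derivative_mult_right[OF b'(2) mult_carrier_mat[OF m smult_carrier_mat[OF BG]] UNIV_I mB this]
  have "has_mat_derivative (\<lambda>u. m * B u * qadjoint b)
      (m * ((-2) \<cdot>\<^sub>m (B t * ?G)) * qadjoint b) (at t within UNIV)" .
  moreover have "m * ((-2) \<cdot>\<^sub>m (B t * ?G)) = (-2) \<cdot>\<^sub>m (m * B t * ?G)"
    using mat_mult_smult_of_real[OF m BG, of "- 2"] assoc_mult_mat[OF m B G] by simp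
  moreover have "(-2) \<cdot>\<^sub>m (m * B t * ?G) * qadjoint b = (-2) \<cdot>\<^sub>m (m * B t * ?G * qadjoint b)"
    by (rule smult_mat_mult[OF mult_carrier_mat[OF mB G] b'(2)])
  moreover have "?X * qadjoint (P t) * P t = m * B t * ?G * qadjoint b"
    using mult_gram_singular_value_form[OF X P b gram] mult_qadjoint_mult_Sp[OF mB b] by simp
  ultimately show "has_mat_derivative (\<lambda>u. m * B u * qadjoint b)
      ((-2) \<cdot>\<^sub>m (?X * qadjoint (P t) * P t)) (at t within UNIV)"
    by simp
qed

section \<open>Uniqueness\<close>

lemma zero_vector_derivative_imp_eq:
  fixes f :: "real \<Rightarrow> 'a::real_normed_vector"
  assumes "connected J" and "x \<in> J" and "y \<in> J"
    and "\<And>t. t \<in> J \<Longrightarrow> (f has_vector_derivative 0) (at t within J)"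
  shows "f x = f y"
proof -
  have "convex J"
    using assms(1) is_interval_connected_1 is_interval_convex by blast
  then show ?thesis
    using has_vector_derivative_zero_constant[of J f] assms(2-4) by metis
qed

text \<open>
  The derivative of \<open>\<phi> w\<close> is \<open>\<phi> (-2 g w) + 2 g \<phi> w = 0\<close>. The function \<open>\<phi>\<close> is a parameter, so
  that an explicit integrating factor can be supplied.
\<close>

lemma integrating_factor_constant:
  fixes w :: "real \<Rightarrow> 'a::real_normed_vector"
  assumes conn: "connected J" and x: "x \<in> J" and y: "y \<in> J"
    and w: "\<And>t. t \<in> J \<Longrightarrow> (w has_vector_derivative (- (2 * g t)) *\<^sub>R w t) (at t within J)"
    and phi: "\<And>t. (\<phi> has_real_derivative 2 * g t * \<phi> t) (at t)"
  shows "\<phi> x *\<^sub>R w x = \<phi> y *\<^sub>R w y"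
proof -
  have "((\<lambda>t. \<phi> t *\<^sub>R w t) has_vector_derivative 0) (at t within J)" if t: "t \<in> J" for t
    using has_vector_derivative_scaleR[OF has_field_derivative_at_within[OF phi] w[OF t]]
    by (simp add: mult.commute)
  then show ?thesis
    by (rule zero_vector_derivative_imp_eq[OF conn x y])
qed

lemma has_mat_derivative_within_subset:
  "has_mat_derivative F D (at t within K) \<Longrightarrow> J \<subseteq> K \<Longrightarrow> has_mat_derivative F D (at t within J)"
  unfolding has_mat_derivative_def by (blast intro: has_vector_derivative_within_subset)

lemma T_solution_subset:
  assumes "T_solution l k P T0 K T" and "J \<subseteq> K"
  shows "T_solution l k P T0 J T"
  using assms unfolding T_solution_def by (blast intro: has_mat_derivative_within_subset)

text \<open>
  The entries of \<open>S b\<close> and \<open>T b\<close> solve the same scalar equations, so that \<open>S b = T b\<close> after division by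
  the integrating factors. This identity goes back into the differential equation, whose right-hand
  side depends on the solution only through its product with \<open>b\<close>: \<open>S\<close> and \<open>T\<close> have equal derivatives
  and equal initial values.
\<close>

lemma T_solution_unique:
  assumes b: "b \<in> Sp k"
    and P: "\<And>t. P t \<in> carrier_mat k k"
    and gram: "\<And>t. qadjoint (P t) * P t = b * real_diag k (g t) * qadjoint b"
    and phi: "\<And>j t. j < k \<Longrightarrow> (\<phi> j has_real_derivative 2 * g t j * \<phi> j t) (at t)"
    and pos: "\<And>j t. j < k \<Longrightarrow> \<phi> j t > 0"
    and conn: "connected J" and 0: "0 \<in> J"
    and S: "T_solution l k P T0 J S" and T: "T_solution l k P T0 J T"
    and t: "t \<in> J"
  shows "S t = T t"
proof -
  note b' = SpD[OF b]
  note rhs = mult_gram_singular_value_form[OF _ P b gram]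
  have weighted: "\<phi> j u *\<^sub>R (R u * b) $$ (i, j) = \<phi> j 0 *\<^sub>R (T0 * b) $$ (i, j)"
    if R: "T_solution l k P T0 J R" and u: "u \<in> J" and i: "i < l" and j: "j < k" for R u i j
  proof -
    have R0: "R 0 = T0" and Rc: "\<And>v. v \<in> J \<Longrightarrow> R v \<in> carrier_mat l k"
      and Rd: "\<And>v. v \<in> J \<Longrightarrow> has_mat_derivative R
        ((-2) \<cdot>\<^sub>m (R v * qadjoint (P v) * P v)) (at v within J)"
      using R by (simp_all add: T_solution_def)
    have "((\<lambda>u. (R u * b) $$ (i, j)) has_vector_derivative
        (- (2 * g v j)) *\<^sub>R (R v * b) $$ (i, j)) (at v within J)" if v: "v \<in> J" for v
    proof -
      let ?D = "(-2) \<cdot>\<^sub>m (R v * qadjoint (P v) * P v)"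
      have Rb: "R v * b \<in> carrier_mat l k" using Rc[OF v] b' by simp
      have Rbg: "R v * b * real_diag k (g v) \<in> carrier_mat l k" using Rb by simp
      have Dc: "?D \<in> carrier_mat l k"
        by (intro smult_carrier_mat mult_carrier_mat[OF _ P] mult_carrier_mat[OF Rc[OF v]]
            qadjoint_carrier P)
      have "?D * b = (-2) \<cdot>\<^sub>m (R v * b * real_diag k (g v) * qadjoint b * b)"
        unfolding rhs[OF Rc[OF v]] by (rule smult_mat_mult[OF mult_carrier_mat[OF Rbg b'(2)] b'(1)])
      also have "R v * b * real_diag k (g v) * qadjoint b * b = R v * b * real_diag k (g v)"
        by (rule mult_qadjoint_mult_Sp[OF Rbg b])
      finally have "(?D * b) $$ (i, j) = (-2) * (g v j *\<^sub>R (R v * b) $$ (i, j))"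
        using carrier_matD[OF Rbg] i j mult_real_diag_entry[OF Rb i j] by (simp del: index_mult_mat)
      also have "\<dots> = (- (2 * g v j)) *\<^sub>R (R v * b) $$ (i, j)"
        by (simp add: scaleR_conv_of_real mult.assoc del: index_mult_mat)
      finally have entry: "(?D * b) $$ (i, j) = (- (2 * g v j)) *\<^sub>R (R v * b) $$ (i, j)" .
      have "((\<lambda>u. (R u * b) $$ (i, j)) has_vector_derivative (?D * b) $$ (i, j)) (at v within J)"
        using has_mat_derivative_mult_right[OF b'(1) Dc v Rc Rd[OF v]]
          carrier_matD[OF mult_carrier_mat[OF Dc b'(1)]] i j
        unfolding has_mat_derivative_def by simp
      then show ?thesis unfolding entry .
    qed
    from integrating_factor_constant[OF conn u 0 this phi[OF j]] show ?thesis
      by (simp add: R0)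
  qed
  have Sc: "\<And>u. u \<in> J \<Longrightarrow> S u \<in> carrier_mat l k" and Tc: "\<And>u. u \<in> J \<Longrightarrow> T u \<in> carrier_mat l k"
    using S T by (simp_all add: T_solution_def)
  have same: "S u * b = T u * b" if u: "u \<in> J" for u
  proof (rule eq_matI)
    fix i j assume "i < dim_row (T u * b)" "j < dim_col (T u * b)"
    hence i: "i < l" and j: "j < k" using Tc[OF u] b' by simp_all
    have "\<phi> j u *\<^sub>R (S u * b) $$ (i, j) = \<phi> j u *\<^sub>R (T u * b) $$ (i, j)"
      using weighted[OF S u i j] weighted[OF T u i j] by (simp del: index_mult_mat(1))
    with pos[OF j, of u] show "(S u * b) $$ (i, j) = (T u * b) $$ (i, j)"
      by (simp del: index_mult_mat(1))
  qed (use Sc[OF u] Tc[OF u] b' in simp_all)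
  show ?thesis
  proof (rule eq_matI)
    fix i j assume "i < dim_row (T t)" "j < dim_col (T t)"
    hence i: "i < l" and j: "j < k" using Tc[OF t] by simp_all
    have "((\<lambda>u. S u $$ (i, j) - T u $$ (i, j)) has_vector_derivative 0) (at u within J)"
      if u: "u \<in> J" for u
    proof -
      let ?E = "(-2) \<cdot>\<^sub>m (T u * b * real_diag k (g u) * qadjoint b)"
      have "has_mat_derivative S ?E (at u within J)" "has_mat_derivative T ?E (at u within J)"
        using S T u rhs[OF Sc[OF u], of u] rhs[OF Tc[OF u], of u] same[OF u]
        unfolding T_solution_def by auto
      moreover have "?E \<in> carrier_mat l k"
        by (intro smult_carrier_mat mult_carrier_mat[OF _ b'(2)] mult_carrier_mat[OF _ real_diag_carrier]
            mult_carrier_mat[OF Tc[OF u] b'(1)])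
      ultimately show ?thesis
        using i j has_vector_derivative_diff[of "\<lambda>u. S u $$ (i, j)" "?E $$ (i, j)" "at u within J"
            "\<lambda>u. T u $$ (i, j)" "?E $$ (i, j)"]
        unfolding has_mat_derivative_def carrier_mat_def by simp
    qed
    then have "S t $$ (i, j) - T t $$ (i, j) = S 0 $$ (i, j) - T 0 $$ (i, j)"
      by (rule zero_vector_derivative_imp_eq[OF conn t 0])
    also have "\<dots> = 0" using S T by (simp add: T_solution_def)
    finally show "S t $$ (i, j) = T t $$ (i, j)" by simp
  qed (use Sc[OF t] Tc[OF t] in simp_all)
qed

section \<open>The block normal forms\<close>

lemma real_diag_entry:
  "i < q \<Longrightarrow> j < q \<Longrightarrow> real_diag q d $$ (i, j) = (if i = j then of_real (d j) else 0)"
  by (simp add: real_diag_def mat_diag_def)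

text \<open>
  The entries are written relative to the block that contains them, because this is how they are
  read off from the recursion over the list of blocks.
\<close>

lemma diag_block_mat_triple:
  assumes A: "A \<in> carrier_mat ra ca" and B: "B \<in> carrier_mat rb cb" and C: "C \<in> carrier_mat rc cc"
  shows "diag_block_mat [A, B, C] \<in> carrier_mat (ra + rb + rc) (ca + cb + cc)"
    and "i < ra + rb + rc \<Longrightarrow> j < ca + cb + cc \<Longrightarrow> diag_block_mat [A, B, C] $$ (i, j) =
      (if i < ra then if j < ca then A $$ (i, j) else 0
       else if j < ca then 0
       else if i - ra < rb then if j - ca < cb then B $$ (i - ra, j - ca) else 0
       else if j - ca < cb then 0
       else C $$ (i - ra - rb, j - ca - cb))"
proof -
  let ?BC = "four_block_mat B (0\<^sub>m rb cc) (0\<^sub>m rc cb) C"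
  have C1: "diag_block_mat [C] = C"
    by (rule eq_matI) (use C in \<open>simp_all add: Let_def\<close>)
  have BC: "diag_block_mat [B, C] = ?BC"
    using B C by (simp only: diag_block_mat.simps(2)[of B] C1 Let_def carrier_matD)
  have dims: "dim_row ?BC = rb + rc" "dim_col ?BC = cb + cc"
    using B C by simp_all
  have ABC: "diag_block_mat [A, B, C] = four_block_mat A (0\<^sub>m ra (cb + cc)) (0\<^sub>m (rb + rc) ca) ?BC"
    using A by (simp only: diag_block_mat.simps(2)[of A] BC Let_def carrier_matD dims)
  show "diag_block_mat [A, B, C] \<in> carrier_mat (ra + rb + rc) (ca + cb + cc)"
    unfolding ABC using A B C by (intro carrier_matI) simp_all
  assume i: "i < ra + rb + rc" and j: "j < ca + cb + cc"
  have "diag_block_mat [A, B, C] $$ (i, j) =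
      (if i < ra then if j < ca then A $$ (i, j) else 0\<^sub>m ra (cb + cc) $$ (i, j - ca)
       else if j < ca then 0\<^sub>m (rb + rc) ca $$ (i - ra, j) else ?BC $$ (i - ra, j - ca))"
    unfolding ABC using A i j dims by (subst index_mat_four_block) simp_all
  moreover have "?BC $$ (i - ra, j - ca) =
      (if i - ra < rb then if j - ca < cb then B $$ (i - ra, j - ca) else 0
       else if j - ca < cb then 0 else C $$ (i - ra - rb, j - ca - cb))"
    if "\<not> i < ra" "\<not> j < ca"
    using B C i j that by (subst index_mat_four_block) auto
  ultimately show "diag_block_mat [A, B, C] $$ (i, j) =
      (if i < ra then if j < ca then A $$ (i, j) else 0
       else if j < ca then 0
       else if i - ra < rb then if j - ca < cb then B $$ (i - ra, j - ca) else 0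
       else if j - ca < cb then 0
       else C $$ (i - ra - rb, j - ca - cb))"
    using i j by simp
qed

lemma diag_block_P_eq_real_diag:
  "diag_block_mat [1\<^sub>m p, real_diag q c, 0\<^sub>m r r] =
    real_diag (p + q + r) (\<lambda>j. if j < p then 1 else if j < p + q then c (j - p) else 0)"
    (is "?L = ?R")
proof (rule eq_matI)
  note triple = diag_block_mat_triple[OF one_carrier_mat[of p] real_diag_carrier[of q c] zero_carrier_mat[of r r]]
  show "dim_row ?L = dim_row ?R" "dim_col ?L = dim_col ?R"
    using carrier_matD[OF triple(1)] carrier_matD[OF real_diag_carrier] by metis+
  fix i j assume "i < dim_row ?R" "j < dim_col ?R"
  hence i: "i < p + q + r" and j: "j < p + q + r"
    using carrier_matD[OF real_diag_carrier] by metis+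
  show "?L $$ (i, j) = ?R $$ (i, j)"
    unfolding triple(2)[OF i j] real_diag_entry[OF i j]
    using i j by (auto simp: real_diag_entry)
qed

definition T_block :: "nat \<Rightarrow> nat \<Rightarrow> nat \<Rightarrow> nat \<Rightarrow> (nat \<Rightarrow> real) \<Rightarrow> quat mat" where
  "T_block p' p q r s = diag_block_mat [0\<^sub>m p' p, real_diag q (\<lambda>i. - s i), - 1\<^sub>m r]"

lemma T_block_cong:
  assumes "\<And>i. i < q \<Longrightarrow> s i = s' i"
  shows "T_block p' p q r s = T_block p' p q r s'"
proof -
  have "real_diag q (\<lambda>i. - s i) = real_diag q (\<lambda>i. - s' i)"
    by (rule eq_matI) (auto simp: real_diag_def mat_diag_def assms)
  then show ?thesis by (simp add: T_block_def)
qed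

lemma T_block_carrier [simp]: "T_block p' p q r s \<in> carrier_mat (p' + q + r) (p + q + r)"
  unfolding T_block_def by (rule diag_block_mat_triple(1)) simp_all

text \<open>
  The rows are split as \<open>p' + q + r\<close> and the columns as \<open>p + q + r\<close>, so the entries of the \<open>q\<close> and \<open>r\<close>
  blocks lie on the shifted diagonal \<open>i - p' = j - p\<close>. The conditions \<open>i < p'\<close> and \<open>j < p\<close> come first
  because the subtraction is truncated.
\<close>

lemma T_block_entry:
  assumes "i < p' + q + r" "j < p + q + r"
  shows "T_block p' p q r s $$ (i, j) =
    of_real (if i < p' \<or> j < p \<or> i - p' \<noteq> j - p then 0
             else if j < p + q then - s (j - p) else - 1)"
proof -
  note triple = diag_block_mat_triple(2)[OF zero_carrier_mat[of p' p] real_diag_carrier[of q "\<lambda>i. - s i"]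
      uminus_carrier_mat[OF one_carrier_mat[of r]]]
  show ?thesis
    unfolding T_block_def triple[OF assms] using assms by (auto simp: real_diag_entry)
qed

text \<open>
  With \<open>E = 1 + K e\<^bsup>4t\<^esup>\<close> and \<open>c\<^sup>2 = (E - 1) / E\<close>,
  \<open>2 c\<^sup>2 = (log E)' / 2\<close>, so \<open>exp\<close> of an antiderivative of \<open>2 c\<^sup>2\<close> is \<open>sqrt E\<close>.
\<close>

lemma logistic_integrating_factor:
  fixes K t :: real
  assumes "K > 0"
  shows "((\<lambda>t. sqrt (1 + K * exp (4 * t))) has_real_derivative
      2 * (K * exp (4 * t) / (1 + K * exp (4 * t))) * sqrt (1 + K * exp (4 * t))) (at t)"
proof -
  let ?E = "1 + K * exp (4 * t)"
  have pos: "?E > 0" using assms by (simp add: add_pos_pos)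
  have "((\<lambda>t. 1 + K * exp (4 * t)) has_real_derivative 4 * (K * exp (4 * t))) (at t)"
    by (auto intro!: derivative_eq_intros)
  from DERIV_chain2[OF DERIV_real_sqrt[OF pos] this]
  have "((\<lambda>t. sqrt (1 + K * exp (4 * t))) has_real_derivative
      inverse (sqrt ?E) / 2 * (4 * (K * exp (4 * t)))) (at t)" .
  moreover have "inverse (sqrt ?E) = sqrt ?E / ?E"
    using sqrt_divide_self_eq[of ?E] pos by simp
  ultimately show ?thesis by (simp add: mult_ac)
qed

text \<open>
  The sine \<open>s = E\<^bsup>-1/2\<^esup>\<close> is the reciprocal of the integrating factor, which turns the rate
  \<open>2 c\<^sup>2\<close> into \<open>-2 c\<^sup>2\<close>.
\<close>

lemma logistic_sine_derivative:
  fixes K t :: real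
  assumes "K > 0"
  shows "((\<lambda>t. inverse (sqrt (1 + K * exp (4 * t)))) has_real_derivative
      - (2 * (K * exp (4 * t) / (1 + K * exp (4 * t))) * inverse (sqrt (1 + K * exp (4 * t))))) (at t)"
proof -
  let ?\<phi> = "sqrt (1 + K * exp (4 * t))"
  have "?\<phi> \<noteq> 0" using assms by (simp add: add_pos_pos less_imp_neq[symmetric])
  moreover have "inverse y * (2 * x * y) * inverse y = 2 * x * inverse y" if "y \<noteq> 0" for x y :: real
    using that by (simp add: field_simps)
  ultimately have "inverse ?\<phi> * (2 * x * ?\<phi>) * inverse ?\<phi> = 2 * x * inverse ?\<phi>" for x
    by blast
  with DERIV_inverse'[OF logistic_integrating_factor[OF assms] \<open>?\<phi> \<noteq> 0\<close>]
  show ?thesis by (simp only:)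
qed

section \<open>The solution in normal form\<close>

theorem lemma5p2:
  fixes n k p p' q r :: nat
    and a b m T0 :: "quat mat"
    and P :: "real \<Rightarrow> quat mat"
    and c C s0 :: "nat \<Rightarrow> real"
    and ct :: "nat \<Rightarrow> real \<Rightarrow> real"
  assumes "k < n"
    and "p + q + r = k" and "p' + q + r = n - k"
    and "a \<in> Sp k" and "b \<in> Sp k" and "m \<in> Sp (n - k)"
    and "T0 \<in> carrier_mat (n - k) k" and "P 0 \<in> carrier_mat k k"
    and "T0 @\<^sub>r P 0 \<in> stiefel n k"
    and "\<And>i. i < q \<Longrightarrow> 0 < c i \<and> c i < 1"
    and "\<And>i. i < q \<Longrightarrow> s0 i = sqrt (1 - (c i)\<^sup>2)"
    and "P 0 = a * diag_block_mat [1\<^sub>m p, real_diag q c, 0\<^sub>m r r] * qadjoint b"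
    and "T0 = m * diag_block_mat [0\<^sub>m p' p, real_diag q (\<lambda>i. - s0 i), - 1\<^sub>m r] * qadjoint b"
    and "\<And>i. i < q \<Longrightarrow> C i > 0 \<and> (c i)\<^sup>2 = C i / (1 + C i)"
    and "\<And>i t. i < q \<Longrightarrow> ct i t > 0 \<and> (ct i t)\<^sup>2 = C i * exp (4 * t) / (1 + C i * exp (4 * t))"
    and "\<And>t. P t = a * diag_block_mat [1\<^sub>m p, real_diag q (\<lambda>i. ct i t), 0\<^sub>m r r] * qadjoint b"
  shows "\<exists>s :: nat \<Rightarrow> real \<Rightarrow> real.
      (\<forall>i<q. \<forall>t. s i t > 0 \<and> (s i t)\<^sup>2 = 1 - (ct i t)\<^sup>2
                 \<and> 1 - (ct i t)\<^sup>2 = 1 / (1 + C i * exp (4 * t))) \<and>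
      (let T = (\<lambda>t. m * diag_block_mat [0\<^sub>m p' p, real_diag q (\<lambda>i. - s i t), - 1\<^sub>m r] * qadjoint b)
       in T_solution (n - k) k P T0 UNIV T \<and>
          (\<forall>J S. connected J \<and> 0 \<in> J \<and> T_solution (n - k) k P T0 J S \<longrightarrow> (\<forall>t\<in>J. S t = T t)))"
proof -
  note kn = \<open>p + q + r = k\<close> and ln = \<open>p' + q + r = n - k\<close>
  define s where "s i t = inverse (sqrt (1 + C i * exp (4 * t)))" for i t
  (* the singular values of P t, in the order of the columns *)
  define d where "d t j = (if j < p then 1 else if j < p + q then ct (j - p) t else 0)" for t j
  (* \<phi> j is the exponential of an antiderivative of 2 (d t j)^2, so it solves the adjoint of the
     scalar equation in column j *)
  define \<phi> where "\<phi> j t = (if j < p then exp (2 * t)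
      else if j < p + q then sqrt (1 + C (j - p) * exp (4 * t)) else 1)" for j t
  define B where "B t = T_block p' p q r (\<lambda>i. s i t)" for t
  have Cpos: "C i > 0" and ct2: "(ct i t)\<^sup>2 = C i * exp (4 * t) / (1 + C i * exp (4 * t))"
    if "i < q" for i t
    using assms(14)[OF that] assms(15)[OF that, of t] by simp_all
  have Epos: "1 + C i * exp (4 * t) > 0" if "i < q" for i t
    using Cpos[OF that] by (simp add: add_pos_pos)
  have s: "s i t > 0" "(s i t)\<^sup>2 = 1 - (ct i t)\<^sup>2"
    "1 - (ct i t)\<^sup>2 = 1 / (1 + C i * exp (4 * t))" if i: "i < q" for i t
  proof -
    show "s i t > 0" using Epos[OF i] by (simp add: s_def)
    show *: "1 - (ct i t)\<^sup>2 = 1 / (1 + C i * exp (4 * t))"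
      using Epos[OF i, of t] by (simp add: ct2[OF i] field_simps)
    show "(s i t)\<^sup>2 = 1 - (ct i t)\<^sup>2"
      using Epos[OF i, of t] unfolding * by (simp add: s_def inverse_eq_divide power_divide)
  qed
  have s0: "s i 0 = s0 i" if i: "i < q" for i
  proof -
    have "(s i 0)\<^sup>2 = 1 - (c i)\<^sup>2"
      using s(2)[OF i, of 0] ct2[OF i, of 0] assms(14)[OF i] by simp
    then show ?thesis
      using assms(11)[OF i] s(1)[OF i, of 0] by (metis less_imp_le real_sqrt_unique)
  qed
  have P: "P t = a * real_diag k (d t) * qadjoint b" for t
    unfolding assms(16) diag_block_P_eq_real_diag kn d_def ..
  note gram = gram_singular_value_form[OF \<open>a \<in> Sp k\<close> \<open>b \<in> Sp k\<close> P]
  have Bc: "B t \<in> carrier_mat (n - k) k" for t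
    using T_block_carrier[of p' p q r "\<lambda>i. s i t"] unfolding kn ln B_def .
  have T0: "T0 = m * B 0 * qadjoint b"
  proof -
    have "diag_block_mat [0\<^sub>m p' p, real_diag q (\<lambda>i. - s0 i), - 1\<^sub>m r] = B 0"
      unfolding B_def T_block_def[symmetric] by (rule T_block_cong) (simp add: s0)
    then show ?thesis using assms(13) by simp
  qed
  have dB: "((\<lambda>t. B t $$ (i, j)) has_vector_derivative
      (- (2 * (d t j)\<^sup>2)) *\<^sub>R B t $$ (i, j)) (at t)" if "i < n - k" "j < k" for i j t
  proof -
    define e where "e t = (if i < p' \<or> j < p \<or> i - p' \<noteq> j - p then 0
             else if j < p + q then - s (j - p) t else - 1)" for t
    have e: "B t $$ (i, j) = of_real (e t)" for t
      using T_block_entry[of i p' q r j p "\<lambda>i. s i t"] that unfolding kn ln B_def e_def by blast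
    have "(e has_real_derivative - (2 * (d t j)\<^sup>2) * e t) (at t)"
      (* The entry is constant unless it is a sine. A constant solves the equation if it is zero or
         if its column has d t j = 0. *)
    proof (cases "i < p' \<or> j < p \<or> i - p' \<noteq> j - p \<or> \<not> j < p + q")
      case True
      then show ?thesis unfolding e_def d_def by auto
    next
      case False
      then have jq: "j - p < q" by auto
      from DERIV_minus[OF logistic_sine_derivative[OF Cpos[OF jq], of t]] False
      show ?thesis unfolding e_def d_def by (simp add: ct2[OF jq] s_def)
    qed
    from has_vector_derivative_of_real[OF this] show ?thesis
      unfolding e by (simp add: scaleR_conv_of_real)
  qed
  have sol: "T_solution (n - k) k P T0 UNIV (\<lambda>t. m * B t * qadjoint b)"
    unfolding T0
    by (rule T_solution_of_columnwise_decay[OF SpD(1)[OF \<open>m \<in> Sp (n - k)\<close>] \<open>b \<in> Sp k\<close> gram Bc dB])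
  have d\<phi>: "(\<phi> j has_real_derivative 2 * (d t j)\<^sup>2 * \<phi> j t) (at t)" for j t
  proof -
    consider "j < p" | "\<not> j < p" "j < p + q" | "\<not> j < p + q" by blast
    then show ?thesis
    proof cases
      case 1
      then show ?thesis unfolding \<phi>_def d_def by (auto intro!: derivative_eq_intros)
    next
      case 2
      then have jq: "j - p < q" by auto
      from logistic_integrating_factor[OF Cpos[OF jq], of t] 2
      show ?thesis unfolding \<phi>_def d_def by (simp add: ct2[OF jq])
    next
      case 3
      then show ?thesis unfolding \<phi>_def d_def by simp
    qed
  qed
  have \<phi>pos: "\<phi> j t > 0" for j t
    using Epos[of "j - p" t] by (auto simp: \<phi>_def)
  have "S t = m * B t * qadjoint b"
    if "connected J" "0 \<in> J" "T_solution (n - k) k P T0 J S" "t \<in> J" for J S t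
    by (rule T_solution_unique[OF \<open>b \<in> Sp k\<close> gram d\<phi> \<phi>pos that(1-3)
          T_solution_subset[OF sol subset_UNIV] that(4)])
  with sol s show ?thesis
    unfolding B_def T_block_def Let_def by (intro exI[of _ s]) blast
qed

end
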